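(* Let $G=(V,E)$ be the simplicial graph associated to a polyhedral tessellation $\mathcal{P}$ of $\mathbb{R}^d$, let $p=(p_e)_{e\in E}$ with $p_e\in[0,1]$, let $q\ge1$, and fix an enumeration $E=\{e_1,e_2,\dots\}$. Let $\hat p_e=p_e/(p_e+q(1-p_e))$ and $$\hat g_e=2(1-\hat p_e)+3\sum_{e'\in\Delta_{\mathcal{P}}(\{e\})}(1-\hat p_{e'}).$$ Assume that $\hat p_e>0$ for all $e\in E$ and that $$\lim_{\Lambda\uparrow E}\ \sup_{e\notin\Lambda}\hat g_e<1$$ (limit along finite subsets $\Lambda$ of $E$ increasing to $E$). Then for all $e\in E$ the cluster $C^w_e(u)$ is finite for almost all $u\in\mathcal{U}$.
   Context: **Graphs.** A graph $(V,E)$ consists of a set $V$ of vertexes, a set $E$ of edges, and a map from $E$ to unordered pairs of distinct vertexes (the end vertexes of the edge). **Tessellations.** A convex cell is a closed convex subset $A$ of some $\mathbb{R}^\ell$ that is an intersection of finitely many closed half-spaces; $A_i$ is its set of $i$-dimensional faces. If $A$ is a convex cell of dimension $m$ and $\varphi:A\to\mathbb{R}^d$ is an injective continuous piecewise affine map, then $\sigma=\varphi(A)$ is called a cell of $\mathbb{R}^d$ of dimension $m$; the collections $\sigma_i=\{\varphi(B):B\in A_i\}$, $i=0,\dots,m$, form a polyhedron. A polytope $\mathcal{P}$ in $\mathbb{R}^d$ is given by sets $P_0,\dots,P_m$ such that: (i) the elements of $P_i$ are $i$-dimensional cells of $\mathbb{R}^d$; (ii) every bounded region meets only finitely many elements of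 $P_i$; (iii) for $\sigma\in P_i$, setting $P_j(\sigma)=\{\tau\in P_j:\tau\subset\sigma\}$, the collection $P_0(\sigma),\dots,P_i(\sigma)$ is a polyhedron (the elements of $P_j(\sigma)$ are the $j$-faces of $\sigma$); (iv) for $\sigma\in P_i,\tau\in P_j$, $\sigma\cap\tau$ is either empty or a union of faces of $\sigma$ and $\tau$. The polytope is a polyhedral tessellation of $\mathbb{R}^d$ if the union of its cells is $\mathbb{R}^d$. The associated graph $G(\mathcal{P})$, called a simplicial graph, has vertex set $P_0$, edge set $P_1$, the end vertexes of $e\in P_1$ being the two vertexes contained in $e$. For $H\subset P_1$, $\Delta_{\mathcal{P}}(H)$ is the set of edges $e\in P_1\setminus H$ for which there exist $h\in H$ and $\sigma\in P_d$ with $e,h\subset\sigma$. **The graph $G^*$.** $G^*=(V^*,E^* )$ has $V^*=\mathbb{Z}\times V$ and $E^*=(\mathbb{Z}\times E)\cup(\mathbb{Z}\times V)$; the edge $(n,e)$, where $e\in E$ has end vertexes $x,y$, has end vertexes $(n,x),(n,y)$; the edge $e_{n,v}$ corresponding to $(n,v)\in\mathbb{Z}\times V$ has end vertexes $(n,v),(n+1,v)$. $G^*$ is the simplicial graph of the tessellation $\mathcal{P}^*$ of $\mathbb{R}^{d+1}=\mathbb{R}\times\mathbb{R}^d$ whose $i$-dimensional cells are the sets $\{n\}\times\sigma$ ($\sigma$ an $i$-cell of $\mathcal{P}$, $n\in\mathbb{Z}$) and $[n,n+1]\times\tau$ ($\tau$ an $(i-1)$-cell of $\mathcal{P}$, $n\in\mathbb{Z}$).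 $\Delta_{\mathcal{P}^*}$ is defined as $\Delta_{\mathcal{P}}$, using the $(d+1)$-dimensional cells of $\mathcal{P}^*$. **Coloring and clusters.** Let $\mathcal{A}=\{(n,k)\in\mathbb{Z}^2:n\le-1,\ k\ge1\}$ and $\mathcal{U}=[0,1]^{\mathcal{A}}$ with the Lebesgue product measure (so the coordinates $u_{n,k}$ are i.i.d. uniform on $[0,1]$). For $u\in\mathcal{U}$: $W(u)=\{(n,e_k):(n,k)\in\mathcal{A},\ p_{e_k}\le u_{n,k}\le1\}$ (white), $M(u)=\{(n,e_k):(n,k)\in\mathcal{A},\ \hat p_{e_k}\le u_{n,k}<p_{e_k}\}$ (gray), $B(u)=E^*\setminus(M(u)\cup W(u))$ (black). For $F\subset M(u)\cup W(u)$, $C_F^w=C_F^w(u)$ is the minimum subset $H$ of $E^*$ containing $F$ such that every $f\in\Delta_{\mathcal{P}^*}(H)$ belongs to $B(u)$. For $F\subset E$, identified with $\{-1\}\times F\subset E^*$ and not necessarily contained in $M(u)\cup W(u)$, $C_F^w=F\cup C^w_{F\setminus B(u)}$. $C^w_e(u)$ denotes $C^w_{\{e\}}(u)$, i.e. the cluster of $\{(-1,e)\}$. *)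

theory Defs
  imports "HOL-Probability.Probability"
begin

section \<open>Cells and tessellations\<close>

text \<open>A convex cell is a \<^const>\<open>polyhedron\<close> in the sense of the library: a finite intersection of
  closed half-spaces, not necessarily bounded. Its \<open>i\<close>-dimensional faces are the sets \<open>B\<close> with
  \<open>B face_of A\<close> and \<open>aff_dim B = i\<close>; this includes \<open>A\<close> itself and, as
  \<open>aff_dim {} = -1\<close>, excludes the empty face.\<close>

definition piecewise_affine_on :: "'c::euclidean_space set \<Rightarrow> ('c \<Rightarrow> 'a::euclidean_space) \<Rightarrow> bool"
  where "piecewise_affine_on A f \<longleftrightarrow>
    (\<exists>\<C>. finite \<C> \<and> \<Union>\<C> = A \<and>
         (\<forall>C\<in>\<C>. polyhedron C \<and> (\<exists>L b. linear L \<and> (\<forall>x\<in>C. f x = L x + b))))"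

definition cell_chart ::
  "nat \<Rightarrow> 'c::euclidean_space set \<Rightarrow> ('c \<Rightarrow> 'a::euclidean_space) \<Rightarrow> bool"
  where "cell_chart m A f \<longleftrightarrow>
    polyhedron A \<and> aff_dim A = int m \<and>
    inj_on f A \<and> continuous_on A f \<and> piecewise_affine_on A f"

text \<open>The type \<open>'c\<close>, passed as an argument, is the space containing the convex cells that
  parametrize the cells of \<open>'a\<close>; its dimension is unrelated to that of \<open>'a\<close>.\<close>

definition is_cell :: "'c::euclidean_space itself \<Rightarrow> nat \<Rightarrow> 'a::euclidean_space set \<Rightarrow> bool"
  where "is_cell T m \<sigma> \<longleftrightarrow> (\<exists>(A :: 'c set) f. cell_chart m A f \<and> \<sigma> = f ` A)"

definition is_cell_polyhedron ::
  "'c::euclidean_space itself \<Rightarrow> nat \<Rightarrow> (nat \<Rightarrow> 'a::euclidean_space set set) \<Rightarrow> bool"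
  where "is_cell_polyhedron T m Q \<longleftrightarrow>
    (\<exists>(A :: 'c set) f. cell_chart m A f \<and>
       (\<forall>i\<le>m. Q i = {f ` B | B. B face_of A \<and> aff_dim B = int i}))"

definition subcells :: "(nat \<Rightarrow> 'a set set) \<Rightarrow> 'a set \<Rightarrow> nat \<Rightarrow> 'a set set"
  where "subcells P \<sigma> j = {\<tau> \<in> P j. \<tau> \<subseteq> \<sigma>}"

text \<open>A polytope given by \<open>P\<^sub>0, \<dots>, P\<^sub>m\<close> is encoded as a sequence that is empty beyond \<open>m\<close>.\<close>

definition is_cell_polytope ::
  "'c::euclidean_space itself \<Rightarrow> (nat \<Rightarrow> 'a::euclidean_space set set) \<Rightarrow> bool"
  where "is_cell_polytope T P \<longleftrightarrow>
    (\<exists>m. \<forall>i>m. P i = {}) \<and>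
    (\<forall>i. \<forall>\<sigma>\<in>P i. is_cell T i \<sigma>) \<and>
    (\<forall>i S. bounded S \<longrightarrow> finite {\<sigma> \<in> P i. \<sigma> \<inter> S \<noteq> {}}) \<and>
    (\<forall>i. \<forall>\<sigma>\<in>P i. is_cell_polyhedron T i (subcells P \<sigma>)) \<and>
    (\<forall>i j. \<forall>\<sigma>\<in>P i. \<forall>\<tau>\<in>P j. \<sigma> \<inter> \<tau> = {} \<or>
       (\<exists>\<F>. \<F> \<subseteq> (\<Union>k\<le>i. subcells P \<sigma> k) \<inter> (\<Union>k\<le>j. subcells P \<tau> k) \<and> \<sigma> \<inter> \<tau> = \<Union>\<F>))"

definition polyhedral_tessellation ::
  "'c::euclidean_space itself \<Rightarrow> (nat \<Rightarrow> 'a::euclidean_space set set) \<Rightarrow> bool"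
  where "polyhedral_tessellation T P \<longleftrightarrow> is_cell_polytope T P \<and> (\<Union>i. \<Union>(P i)) = UNIV"

section \<open>Simplicial graphs\<close>

record ('v, 'e) multigraph =
  verts :: "'v set"
  edges :: "'e set"
  ends_of :: "'e \<Rightarrow> 'v set"

text \<open>Vertexes are \<open>0\<close>-cells, that is, singletons \<open>{x}\<close>.\<close>

definition simplicial_graph :: "(nat \<Rightarrow> 'a set set) \<Rightarrow> ('a set, 'a set) multigraph"
  where "simplicial_graph P =
    \<lparr>verts = P 0, edges = P 1, ends_of = (\<lambda>e. {v \<in> P 0. v \<subseteq> e})\<rparr>"

definition delta :: "(nat \<Rightarrow> 'a::euclidean_space set set) \<Rightarrow> 'a set set \<Rightarrow> 'a set set"
  where "delta P H =
    {e \<in> P 1 - H. \<exists>h\<in>H. \<exists>\<sigma>\<in>P DIM('a). e \<subseteq> \<sigma> \<and> h \<subseteq> \<sigma>}"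

lemma finite_delta_singleton:
  fixes P :: "nat \<Rightarrow> 'a::euclidean_space set set"
  assumes P: "polyhedral_tessellation TYPE('c::euclidean_space) P" and e: "e \<in> P 1"
  shows "finite (delta P {e})"
proof -
  have pt: "is_cell_polytope TYPE('c) P"
    using P by (simp add: polyhedral_tessellation_def)
  have cells: "is_cell TYPE('c) 1 e"
    using pt e unfolding is_cell_polytope_def by simp
  have fin: "finite {\<sigma> \<in> P i. \<sigma> \<inter> S \<noteq> {}}" if "bounded S" for i S
    using pt that unfolding is_cell_polytope_def by simp
  have poly: "is_cell_polyhedron TYPE('c) i (subcells P \<sigma>)" if "\<sigma> \<in> P i" for i \<sigma>
    using pt that unfolding is_cell_polytope_def by simp
  obtain x where x: "x \<in> e"
  proof -
    obtain A :: "'c set" and f where A: "aff_dim A = 1" and e: "e = f ` A"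
      using cells unfolding is_cell_def cell_chart_def by auto
    from A have "A \<noteq> {}" by auto
    with e show thesis using that by blast
  qed
  have sub: "finite (subcells P \<sigma> 1)" if \<sigma>: "\<sigma> \<in> P DIM('a)" for \<sigma>
  proof -
    obtain A :: "'c set" and f where A: "cell_chart DIM('a) A f"
      and Q: "\<And>i. i \<le> DIM('a) \<Longrightarrow>
        subcells P \<sigma> i = {f ` B | B. B face_of A \<and> aff_dim B = int i}"
      using poly[OF \<sigma>] unfolding is_cell_polyhedron_def by blast
    have "finite ((\<lambda>B. f ` B) ` {B. B face_of A})"
      using A finite_polyhedron_faces unfolding cell_chart_def by blast
    moreover have "subcells P \<sigma> 1 \<subseteq> (\<lambda>B. f ` B) ` {B. B face_of A}"
      using Q[of 1] by (auto simp: Suc_le_eq)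
    ultimately show ?thesis by (rule finite_subset[rotated])
  qed
  have "delta P {e} \<subseteq> (\<Union>\<sigma>\<in>{\<sigma> \<in> P DIM('a). \<sigma> \<inter> {x} \<noteq> {}}. subcells P \<sigma> 1)"
    using x unfolding delta_def subcells_def by auto
  moreover have "finite \<dots>"
    using fin[of "{x}"] sub by auto
  ultimately show ?thesis by (rule finite_subset)
qed

section \<open>The graph in one more dimension\<close>

definition slice :: "int \<Rightarrow> 'a set \<Rightarrow> (real \<times> 'a) set"
  where "slice n \<sigma> = {real_of_int n} \<times> \<sigma>"

definition prism :: "int \<Rightarrow> 'a set \<Rightarrow> (real \<times> 'a) set"
  where "prism n \<tau> = {real_of_int n .. real_of_int (n + 1)} \<times> \<tau>"

definition star_tess :: "(nat \<Rightarrow> 'a set set) \<Rightarrow> nat \<Rightarrow> (real \<times> 'a) set set"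
  where "star_tess P i =
    {slice n \<sigma> | n \<sigma>. \<sigma> \<in> P i} \<union> {prism n \<tau> | n \<tau>. i \<ge> 1 \<and> \<tau> \<in> P (i - 1)}"

text \<open>The edge \<open>(n, e)\<close> of \<open>G\<^sup>*\<close> is \<open>slice n e\<close> and the edge belonging to \<open>(n, v)\<close> is
  \<open>prism n v\<close>.\<close>

abbreviation star_graph :: "(nat \<Rightarrow> 'a set set) \<Rightarrow> ((real \<times> 'a) set, (real \<times> 'a) set) multigraph"
  where "star_graph P \<equiv> simplicial_graph (star_tess P)"

lemma verts_star_graph: "verts (star_graph P) = {slice n v | n v. v \<in> P 0}"
  by (simp add: simplicial_graph_def star_tess_def)

lemma edges_star_graph:
  "edges (star_graph P) = {slice n e | n e. e \<in> P 1} \<union> {prism n v | n v. v \<in> P 0}"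
  by (simp add: simplicial_graph_def star_tess_def)

section \<open>Coloring\<close>

definition p_hat :: "('e \<Rightarrow> real) \<Rightarrow> real \<Rightarrow> 'e \<Rightarrow> real"
  where "p_hat p q e = p e / (p e + q * (1 - p e))"

text \<open>The sum is over a finite set by \<open>finite_delta_singleton\<close>.\<close>

definition g_hat ::
  "(nat \<Rightarrow> 'a::euclidean_space set set) \<Rightarrow> ('a set \<Rightarrow> real) \<Rightarrow> real \<Rightarrow> 'a set \<Rightarrow> real"
  where "g_hat P p q e =
    2 * (1 - p_hat p q e) + 3 * (\<Sum>e'\<in>delta P {e}. 1 - p_hat p q e')"

definition color_index :: "(int \<times> nat) set"
  where "color_index = {(n, k). n \<le> -1 \<and> k \<ge> 1}"

definition color_space :: "(int \<times> nat \<Rightarrow> real) measure"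
  where "color_space = PiM color_index (\<lambda>_. restrict_space lborel {0..1})"

text \<open>Enumerations start at \<open>1\<close>. Unbounded cells are allowed, so there may be only finitely many
  edges; the coordinates \<open>u (n, k)\<close> with \<open>k\<close> beyond their number are then unused.\<close>

definition enum_dom :: "'e set \<Rightarrow> nat set"
  where "enum_dom E = {k. 1 \<le> k \<and> (finite E \<longrightarrow> k \<le> card E)}"

definition is_enumeration :: "(nat \<Rightarrow> 'e) \<Rightarrow> 'e set \<Rightarrow> bool"
  where "is_enumeration en E \<longleftrightarrow> bij_betw en (enum_dom E) E"

context
  fixes P :: "nat \<Rightarrow> 'a::euclidean_space set set"
    and p :: "'a set \<Rightarrow> real" and q :: real
    and en :: "nat \<Rightarrow> 'a set"
    and u :: "int \<times> nat \<Rightarrow> real"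
begin

definition white :: "(real \<times> 'a) set set"
  where "white = {slice n (en k) | n k. (n, k) \<in> color_index \<and> k \<in> enum_dom (P 1) \<and>
    p (en k) \<le> u (n, k) \<and> u (n, k) \<le> 1}"

definition gray :: "(real \<times> 'a) set set"
  where "gray = {slice n (en k) | n k. (n, k) \<in> color_index \<and> k \<in> enum_dom (P 1) \<and>
    p_hat p q (en k) \<le> u (n, k) \<and> u (n, k) < p (en k)}"

definition black :: "(real \<times> 'a) set set"
  where "black = edges (star_graph P) - (gray \<union> white)"

text \<open>\<open>C\<^sup>w\<^sub>F\<close> for a set \<open>F\<close> of white or gray edges.\<close>

definition w_cluster :: "(real \<times> 'a) set set \<Rightarrow> (real \<times> 'a) set set"
  where "w_cluster F =
    (LEAST H. F \<subseteq> H \<and> H \<subseteq> edges (star_graph P) \<and> delta (star_tess P) H \<subseteq> black)"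

text \<open>\<open>C\<^sup>w\<^sub>F\<close> for an arbitrary \<open>F \<subseteq> E\<close>, identified with \<open>{-1} \<times> F\<close>.\<close>

definition w_cluster_base :: "'a set set \<Rightarrow> (real \<times> 'a) set set"
  where "w_cluster_base F = slice (-1) ` F \<union> w_cluster (slice (-1) ` F - black)"

lemma w_cluster_minimum:
  assumes "F \<subseteq> edges (star_graph P)"
  shows "F \<subseteq> w_cluster F" and "w_cluster F \<subseteq> edges (star_graph P)"
    and "delta (star_tess P) (w_cluster F) \<subseteq> black"
    and "\<And>H. F \<subseteq> H \<Longrightarrow> H \<subseteq> edges (star_graph P) \<Longrightarrow> delta (star_tess P) H \<subseteq> black \<Longrightarrow>
      w_cluster F \<subseteq> H"
proof -
  define ok where
    "ok H \<longleftrightarrow> F \<subseteq> H \<and> H \<subseteq> edges (star_graph P) \<and> delta (star_tess P) H \<subseteq> black" for H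
  have top: "ok (edges (star_graph P))"
    using assms by (auto simp: ok_def delta_def simplicial_graph_def)
  have "delta (star_tess P) (\<Inter>(Collect ok)) \<subseteq> black"
  proof
    fix e assume e: "e \<in> delta (star_tess P) (\<Inter>(Collect ok))"
    then obtain H where "ok H" "e \<notin> H"
      by (auto simp: delta_def)
    moreover from this have "e \<in> delta (star_tess P) H"
      using e unfolding delta_def by blast
    ultimately show "e \<in> black"
      by (auto simp: ok_def)
  qed
  then have inter: "ok (\<Inter>(Collect ok))"
    using top unfolding ok_def by blast
  have "w_cluster F = \<Inter>(Collect ok)"
    unfolding w_cluster_def ok_def[symmetric]
    by (rule Least_equality) (use inter in auto)
  with inter show "F \<subseteq> w_cluster F" "w_cluster F \<subseteq> edges (star_graph P)"
    "delta (star_tess P) (w_cluster F) \<subseteq> black"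
    "\<And>H. F \<subseteq> H \<Longrightarrow> H \<subseteq> edges (star_graph P) \<Longrightarrow> delta (star_tess P) H \<subseteq> black \<Longrightarrow>
      w_cluster F \<subseteq> H"
    by (auto simp: ok_def)
qed

end

end

theory Submission
  imports Defs
begin

text \<open>The white and gray edges on slices of negative height form an independent site percolation: call
  the site \<open>(n, k)\<close> open if \<open>u (n, k) \<ge> p_hat e\<^sub>k\<close>, which has probability \<open>1 - p_hat e\<^sub>k\<close>. Two
  slice edges lie in a common top-dimensional cell of the prism tessellation only if their heights
  differ by at most \<open>1\<close> and their projections lie in a common \<open>d\<close>-cell. Hence the cluster of a slice
  edge is contained in a connected cluster of open sites, and \<open>g_hat e\<^sub>k\<close> bounds the expected
  number of open neighbours of \<open>(n, k)\<close>: these are two translates of \<open>e\<^sub>k\<close> and three copies of each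
  edge adjacent to it.

  By assumption there are a finite set \<open>\<Lambda>\<close> of columns and \<open>\<delta> < 1\<close> such that \<open>g_hat \<le> \<delta>\<close> off
  \<open>\<Lambda>\<close>. An open self-avoiding path of length \<open>L\<close> that stays off the columns \<open>\<Lambda>\<close> therefore has
  probability of order \<open>\<delta>\<^sup>L\<close> (\<open>prob_escape_le\<close>), so almost surely no infinite cluster lives off
  \<open>\<Lambda>\<close>. Along the columns \<open>\<Lambda>\<close> the percolation can be supercritical, but it is essentially
  one-dimensional there, and since every \<open>p_hat\<close> is positive it gets interrupted: with a probability
  bounded below uniformly in the height \<open>n\<close>, a block of \<open>R + 1\<close> consecutive heights of \<open>\<Lambda>\<close> is closed
  and no path off \<open>\<Lambda>\<close> bypasses that block (\<open>barrier_probability_bounded_below\<close>). A configuration with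
  infinitely many such barriers and without long paths off \<open>\<Lambda>\<close> has only finite clusters
  (\<open>finite_cluster\<close>), so an infinite cluster exists with probability less than \<open>1\<close>.

  It remains to pass from less than \<open>1\<close> to \<open>0\<close>. Let \<open>I\<^sub>m\<close> be the event of an infinite cluster
  below height \<open>-m\<close>. These events decrease and, by translation invariance, have the same probability,
  which is then that of their intersection. The intersection is a tail event of the independent
  levels, so Kolmogorov's zero-one law applies (\<open>AE_finite_clusters\<close>).\<close>

section \<open>Independent uniform thresholds\<close>

lemma prob_space_unit_interval: "prob_space (restrict_space lborel {0..1::real})"
  by (rule prob_spaceI) (simp add: emeasure_restrict_space space_restrict_space)

interpretation color: product_prob_space "\<lambda>_. restrict_space lborel {0..1::real}" color_index
  by (intro product_prob_space.intro product_prob_space_axioms.intro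
      product_sigma_finite.intro prob_space_imp_sigma_finite prob_space_unit_interval)

interpretation color_space: prob_space color_space
  unfolding color_space_def by (rule color.P.prob_space_axioms)

lemma measurable_color_coordinate:
  assumes "s \<in> color_index"
  shows "(\<lambda>u. u s) \<in> borel_measurable color_space"
proof -
  have "(\<lambda>u. u s) \<in> measurable color_space (restrict_space lborel {0..1::real})"
    unfolding color_space_def using assms by (rule measurable_component_singleton)
  moreover have "(\<lambda>x. x) \<in> borel_measurable (restrict_space lborel {0..1::real})"
    by (intro measurable_restrict_space1) simp
  ultimately show ?thesis
    using measurable_comp[of "\<lambda>u. u s" color_space "restrict_space lborel {0..1::real}" "\<lambda>x. x" borel]
    by (simp add: comp_def)
qed

lemma prob_threshold_cylinder:
  fixes \<theta> :: "int \<times> nat \<Rightarrow> real"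
  assumes fin: "finite S" "finite B" and sub: "S \<subseteq> color_index" "B \<subseteq> color_index"
    and disj: "S \<inter> B = {}" and \<theta>: "\<And>s. s \<in> S \<union> B \<Longrightarrow> 0 \<le> \<theta> s \<and> \<theta> s \<le> 1"
  shows "color_space.prob {u \<in> space color_space. (\<forall>s\<in>S. \<theta> s \<le> u s) \<and> (\<forall>s\<in>B. u s < \<theta> s)}
    = (\<Prod>s\<in>S. 1 - \<theta> s) * (\<Prod>s\<in>B. \<theta> s)"
proof -
  define X where "X s = (if s \<in> S then {\<theta> s..1} else {0..<\<theta> s})" for s
  have space: "0 \<le> u s \<and> u s \<le> 1" if "u \<in> space color_space" "s \<in> color_index" for u s
    using that by (auto simp: color_space_def space_PiM space_restrict_space PiE_iff)
  have X: "X s \<in> sets (restrict_space lborel {0..1::real})" if "s \<in> S \<union> B" for s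
    using \<theta>[OF that] by (auto simp: X_def sets_restrict_space_iff)
  have m: "emeasure (restrict_space lborel {0..1::real}) (X s)
      = ennreal (if s \<in> S then 1 - \<theta> s else \<theta> s)" if "s \<in> S \<union> B" for s
    using \<theta>[OF that] by (subst emeasure_restrict_space) (auto simp: X_def)
  have XS: "u s \<in> X s \<longleftrightarrow> \<theta> s \<le> u s" if "u \<in> space color_space" "s \<in> S" for u s
    using space[OF that(1), of s] that sub by (auto simp: X_def)
  have XB: "u s \<in> X s \<longleftrightarrow> u s < \<theta> s" if "u \<in> space color_space" "s \<in> B" for u s
    using space[OF that(1), of s] that sub disj by (auto simp: X_def)
  have "{u \<in> space color_space. (\<forall>s\<in>S. \<theta> s \<le> u s) \<and> (\<forall>s\<in>B. u s < \<theta> s)}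
      = {u \<in> space color_space. \<forall>s\<in>S \<union> B. u s \<in> X s}" (is "?L = _")
    by (simp add: ball_Un XS XB cong: conj_cong)
  then have "emeasure color_space ?L = (\<Prod>s\<in>S \<union> B. emeasure (restrict_space lborel {0..1}) (X s))"
    using color.emeasure_PiM_Collect[of "S \<union> B" X] fin sub X by (simp add: color_space_def)
  also have "\<dots> = (\<Prod>s\<in>S \<union> B. ennreal (if s \<in> S then 1 - \<theta> s else \<theta> s))"
    by (intro prod.cong refl m)
  also have "\<dots> = ennreal (\<Prod>s\<in>S \<union> B. if s \<in> S then 1 - \<theta> s else \<theta> s)"
    using \<theta> by (intro prod_ennreal) auto
  also have "(\<Prod>s\<in>S \<union> B. if s \<in> S then 1 - \<theta> s else \<theta> s) = (\<Prod>s\<in>S. 1 - \<theta> s) * (\<Prod>s\<in>B. \<theta> s)"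
    using disj fin by (subst prod.union_disjoint) (auto intro!: arg_cong2[of _ _ _ _ "(*)"] prod.cong)
  finally show ?thesis
    using \<theta> by (simp add: measure_def) (intro enn2real_ennreal mult_nonneg_nonneg prod_nonneg; auto)
qed

section \<open>Percolation on columns\<close>

text \<open>Percolation on the columns \<open>K\<close>, stacked over all negative heights: \<open>N\<close> is the horizontal adjacency
  and \<open>1 - t k\<close> the probability that a site of column \<open>k\<close> is open. The finitely many columns in
  \<open>\<Lambda>\<close> are exempt from the condition that a site has fewer than one open neighbour on average.\<close>

locale column_percolation =
  fixes K :: "nat set" and N :: "nat \<Rightarrow> nat set" and t :: "nat \<Rightarrow> real"
    and \<Lambda> :: "nat set" and \<delta> :: real
  assumes K_pos: "K \<subseteq> {1..}"
    and N_finite: "k \<in> K \<Longrightarrow> finite (N k)"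
    and N_sub: "k \<in> K \<Longrightarrow> N k \<subseteq> K"
    and t_pos: "k \<in> K \<Longrightarrow> 0 < t k" and t_le1: "k \<in> K \<Longrightarrow> t k \<le> 1"
    and \<Lambda>_finite: "finite \<Lambda>" and \<Lambda>_sub: "\<Lambda> \<subseteq> K"
    and \<delta>_nonneg: "0 \<le> \<delta>" and \<delta>_less1: "\<delta> < 1"
    and subcritical: "k \<in> K - \<Lambda> \<Longrightarrow> 2 * (1 - t k) + 3 * (\<Sum>k'\<in>N k. 1 - t k') \<le> \<delta>"
begin

definition weight :: "nat \<Rightarrow> real"
  where "weight k = 2 * (1 - t k) + 3 * (\<Sum>k'\<in>N k. 1 - t k')"

definition nbr :: "int \<times> nat \<Rightarrow> (int \<times> nat) set"
  where "nbr s = {fst s - 1, fst s + 1} \<times> {snd s} \<union> {fst s - 1..fst s + 1} \<times> N (snd s)"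

text \<open>Only the sites below height \<open>-m\<close> can be open. The whole percolation is the case \<open>m = 0\<close>; the
  other cutoffs serve to express the tail of the configuration.\<close>

definition is_open :: "nat \<Rightarrow> (int \<times> nat \<Rightarrow> real) \<Rightarrow> int \<times> nat \<Rightarrow> bool"
  where "is_open m u s \<longleftrightarrow> fst s < - int m \<and> snd s \<in> K \<and> t (snd s) \<le> u s"

definition sites :: "(int \<times> nat) set"
  where "sites = {..<0} \<times> K"

fun walk :: "int \<times> nat \<Rightarrow> (int \<times> nat) list \<Rightarrow> bool"
  where "walk z [] = True"
  | "walk z (x # xs) = (x \<in> nbr z \<and> walk x xs)"

definition cluster :: "nat \<Rightarrow> (int \<times> nat \<Rightarrow> real) \<Rightarrow> int \<times> nat \<Rightarrow> (int \<times> nat) set"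
  where "cluster m u v = {last (v # xs) | xs. walk v xs \<and> (\<forall>s\<in>set xs. is_open m u s)}"

text \<open>Openness is asked of the sites after \<open>z\<close> only: a path that leaves from a site in \<open>\<Lambda>\<close> then
  depends on columns outside \<open>\<Lambda>\<close> alone, and so is independent of a closed block in \<open>\<Lambda>\<close>.\<close>

definition escape_path :: "(int \<times> nat \<Rightarrow> real) \<Rightarrow> int \<times> nat \<Rightarrow> (int \<times> nat) list \<Rightarrow> bool"
  where "escape_path u z xs \<longleftrightarrow>
    walk z xs \<and> distinct xs \<and> (\<forall>s\<in>set xs. snd s \<notin> \<Lambda> \<and> is_open 0 u s)"

definition escape_set :: "(int \<times> nat \<Rightarrow> real) \<Rightarrow> int \<times> nat \<Rightarrow> (int \<times> nat) set"
  where "escape_set u z = {last (z # xs) | xs. escape_path u z xs}"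

text \<open>The block of heights \<open>n - R, \<dots>, n\<close> is closed in every column of \<open>\<Lambda>\<close>. A path off \<open>\<Lambda>\<close> around
  this block, from height \<open>m > n\<close> down to height \<open>n - R\<close>, has at least \<open>m - n + R\<close> steps; as
  initial pieces of such paths are again such paths, it suffices to exclude this exact length.\<close>

definition barrier :: "nat \<Rightarrow> int \<Rightarrow> (int \<times> nat \<Rightarrow> real) \<Rightarrow> bool"
  where "barrier R n u \<longleftrightarrow>
    (\<forall>s\<in>{n - int R..n} \<times> \<Lambda>. \<not> is_open 0 u s) \<and>
    (\<forall>s\<in>{n<..<0} \<times> \<Lambda>. \<nexists>xs. length xs = nat (fst s - n) + R \<and> escape_path u s xs)"

lemma sites_color_index: "sites \<subseteq> color_index"
  using K_pos by (auto simp: sites_def color_index_def)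

lemma is_open_sites: "is_open m u s \<Longrightarrow> s \<in> sites"
  by (auto simp: is_open_def sites_def mem_Times_iff)

lemma one_minus_t_nonneg: "k \<in> K \<Longrightarrow> 0 \<le> 1 - t k"
  using t_le1 by auto

lemma weight_nonneg: "k \<in> K \<Longrightarrow> 0 \<le> weight k"
  unfolding weight_def using N_sub one_minus_t_nonneg by (intro add_nonneg_nonneg mult_nonneg_nonneg sum_nonneg) auto

lemma finite_nbr: "snd z \<in> K \<Longrightarrow> finite (nbr z)"
  by (simp add: nbr_def N_finite)

lemma nbr_K: "snd z \<in> K \<Longrightarrow> y \<in> nbr z \<Longrightarrow> snd y \<in> K"
  using N_sub[of "snd z"] by (auto simp: nbr_def)

lemma sum_nbr_le_weight:
  assumes "snd z \<in> K"
  shows "(\<Sum>y\<in>nbr z. 1 - t (snd y)) \<le> weight (snd z)"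
proof -
  obtain n k where z: "z = (n, k)" by (cases z)
  let ?A = "{n - 1, n + 1} \<times> {k}" and ?B = "{n - 1..n + 1} \<times> N k"
  have k: "k \<in> K" using assms z by simp
  have "(\<Sum>y\<in>?A \<union> ?B. 1 - t (snd y)) + (\<Sum>y\<in>?A \<inter> ?B. 1 - t (snd y))
      = (\<Sum>y\<in>?A. 1 - t (snd y)) + (\<Sum>y\<in>?B. 1 - t (snd y))"
    by (rule sum.union_inter) (auto simp: N_finite k)
  moreover have "(\<Sum>y\<in>?A \<inter> ?B. 1 - t (snd y)) \<ge> 0"
    using k one_minus_t_nonneg by (intro sum_nonneg) auto
  moreover have "(\<Sum>y\<in>?A. 1 - t (snd y)) = 2 * (1 - t k)"
    by (simp add: insert_Times_insert)
  moreover have "(\<Sum>y\<in>?B. 1 - t (snd y)) = 3 * (\<Sum>k'\<in>N k. 1 - t k')"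
  proof -
    have "(\<Sum>y\<in>?B. 1 - t (snd y)) = (\<Sum>(i, k')\<in>?B. 1 - t k')"
      by (simp add: split_def)
    also have "\<dots> = (\<Sum>i\<in>{n - 1..n + 1}. \<Sum>k'\<in>N k. 1 - t k')"
      by (rule sum.cartesian_product[symmetric])
    finally show ?thesis by simp
  qed
  ultimately show ?thesis by (simp add: nbr_def z weight_def)
qed

lemma walk_append: "walk z (xs @ ys) \<longleftrightarrow> walk z xs \<and> walk (last (z # xs)) ys"
  by (induction xs arbitrary: z) auto

lemma walk_level: "walk z xs \<Longrightarrow> \<bar>fst (last (z # xs)) - fst z\<bar> \<le> int (length xs)"
proof (induction xs arbitrary: z)
  case (Cons x xs)
  then have "\<bar>fst (last (x # xs)) - fst x\<bar> \<le> int (length xs)" "\<bar>fst x - fst z\<bar> \<le> 1"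
    by (auto simp: nbr_def)
  then show ?case by auto
qed simp

lemma walk_K: "walk z xs \<Longrightarrow> snd z \<in> K \<Longrightarrow> snd ` set xs \<subseteq> K"
  by (induction xs arbitrary: z) (auto dest: nbr_K)

lemma finite_walks: "snd z \<in> K \<Longrightarrow> finite {xs. walk z xs \<and> length xs = L}"
proof (induction L arbitrary: z)
  case (Suc L)
  have "{xs. walk z xs \<and> length xs = Suc L}
      = (\<Union>x\<in>nbr z. (#) x ` {xs. walk x xs \<and> length xs = L})"
    by (auto simp: length_Suc_conv)
  then show ?case
    using Suc finite_nbr nbr_K by auto
qed simp

lemma escape_path_take: "escape_path u z xs \<Longrightarrow> escape_path u z (take L xs)"
  using walk_append[of z "take L xs" "drop L xs"]
  by (auto simp: escape_path_def dest: in_set_takeD)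

lemma cluster_step:
  assumes "y \<in> cluster m u v" "x \<in> nbr y" "is_open m u x"
  shows "x \<in> cluster m u v"
proof -
  obtain xs where xs: "walk v xs" "\<forall>s\<in>set xs. is_open m u s" "y = last (v # xs)"
    using assms(1) by (auto simp: cluster_def)
  then have "walk v (xs @ [x])" "\<forall>s\<in>set (xs @ [x]). is_open m u s" "x = last (v # xs @ [x])"
    using assms by (auto simp: walk_append)
  then show ?thesis unfolding cluster_def by blast
qed

lemma cluster_K: "snd v \<in> K \<Longrightarrow> y \<in> cluster m u v \<Longrightarrow> snd y \<in> K"
proof -
  assume v: "snd v \<in> K" and "y \<in> cluster m u v"
  then obtain xs where xs: "walk v xs" "y = last (v # xs)" unfolding cluster_def by blast
  have "snd ` set (v # xs) \<subseteq> K" using walk_K[OF xs(1) v] v by simp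
  then show "snd y \<in> K" unfolding xs(2) using last_in_set[of "v # xs"] by blast
qed

lemma cluster_refl: "v \<in> cluster m u v"
  unfolding cluster_def by (auto intro!: exI[of _ "[]"])

lemma escape_set_step:
  assumes "y \<in> escape_set u z" "x \<in> nbr y" "is_open 0 u x" "snd x \<notin> \<Lambda>"
  shows "x \<in> escape_set u z"
proof -
  obtain xs where xs: "escape_path u z xs" "y = last (z # xs)"
    using assms(1) by (auto simp: escape_set_def)
  show ?thesis
  proof (cases "x \<in> set xs")
    case True
    then obtain as bs where "xs = (as @ [x]) @ bs"
      by (auto simp: in_set_conv_decomp)
    then have "escape_path u z (as @ [x])"
      using xs(1) by (simp add: escape_path_def walk_append)
    then show ?thesis
      unfolding escape_set_def by (intro CollectI exI[of _ "as @ [x]"]) simp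
  next
    case False
    then have "escape_path u z (xs @ [x])"
      using xs assms by (auto simp: escape_path_def walk_append)
    then show ?thesis
      unfolding escape_set_def by (intro CollectI exI[of _ "xs @ [x]"]) simp
  qed
qed

lemma escape_set_refl: "z \<in> escape_set u z"
  unfolding escape_set_def escape_path_def by (auto intro!: exI[of _ "[]"])

lemma escape_set_K: "snd z \<in> K \<Longrightarrow> y \<in> escape_set u z \<Longrightarrow> snd y \<in> K"
  unfolding escape_set_def escape_path_def using walk_K[of z] by (fastforce split: if_splits)

text \<open>Initial pieces of escape paths are escape paths, so one missing length bounds all lengths.\<close>

lemma finite_escape_set:
  assumes "snd z \<in> K" "\<nexists>xs. length xs = L \<and> escape_path u z xs"
  shows "finite (escape_set u z)"
proof -
  have "length xs < L" if "escape_path u z xs" for xs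
  proof (rule ccontr)
    assume "\<not> length xs < L"
    then have "length (take L xs) = L" by simp
    then show False using assms(2) escape_path_take[OF that] by blast
  qed
  then have "escape_set u z \<subseteq> (\<lambda>xs. last (z # xs)) ` (\<Union>l<L. {xs. walk z xs \<and> length xs = l})"
    by (auto simp: escape_set_def escape_path_def simp del: last.simps)
  then show ?thesis
    by (rule finite_subset) (intro finite_imageI finite_UN_I finite_walks assms finite_lessThan)
qed

section \<open>Barriers confine clusters\<close>

text \<open>A path off \<open>\<Lambda>\<close> that starts in \<open>\<Lambda>\<close> above the barrier stays above height \<open>n - R\<close>. When it
  reenters \<open>\<Lambda>\<close>, its height is at least \<open>n - R\<close>, and the closed block leaves only heights above \<open>n\<close>.\<close>

lemma barrier_blocks:
  assumes b: "barrier R n u" and z: "snd z \<in> \<Lambda>" "n < fst z" "fst z < 0"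
    and y: "y \<in> escape_set u z" and x: "x \<in> nbr y" "is_open 0 u x" "snd x \<in> \<Lambda>"
  shows "n < fst x"
proof -
  obtain xs where xs: "escape_path u z xs" "y = last (z # xs)"
    using y by (auto simp: escape_set_def)
  have "n - int R < fst y"
  proof (rule ccontr)
    assume "\<not> n - int R < fst y"
    then have "nat (fst z - n) + R \<le> length xs"
      using walk_level[of z xs] xs z by (simp add: escape_path_def)
    then have "length (take (nat (fst z - n) + R) xs) = nat (fst z - n) + R" by simp
    moreover have "z \<in> {n<..<0} \<times> \<Lambda>" using z by (simp add: mem_Times_iff)
    ultimately show False
      using b escape_path_take[OF xs(1)] unfolding barrier_def by blast
  qed
  then have "n - int R \<le> fst x" using x(1) by (auto simp: nbr_def)
  moreover have "x \<notin> {n - int R..n} \<times> \<Lambda>" using b x unfolding barrier_def by blast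
  ultimately show ?thesis using x by (auto simp: mem_Times_iff)
qed

text \<open>Cut a path from \<open>v\<close> at its visits to \<open>\<Lambda>\<close>. The first visit is to a neighbour of the finite set that
  \<open>v\<close> reaches off \<open>\<Lambda>\<close>, so there is a barrier below all possible first visits. By
  \<open>barrier_blocks\<close> all later visits stay above it too, which leaves finitely many of them, and each
  reaches a finite set off \<open>\<Lambda>\<close>.\<close>

lemma finite_cluster:
  assumes v: "snd v \<in> K"
    and esc: "\<And>z. snd z \<in> K \<Longrightarrow> \<exists>L. \<nexists>xs. length xs = L \<and> escape_path u z xs"
    and bar: "\<And>n0. \<exists>n<n0. barrier R n u"
  shows "finite (cluster 0 u v)"
proof -
  have fin: "finite (escape_set u z)" if "snd z \<in> K" for z
    using esc[OF that] finite_escape_set[OF that] by blast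
  have "finite (\<Union>x\<in>escape_set u v. nbr x)"
    using fin v escape_set_K finite_nbr by auto
  then obtain n0 where n0: "\<And>y. y \<in> (\<Union>x\<in>escape_set u v. nbr x) \<Longrightarrow> n0 \<le> fst y"
    using bdd_below_finite[of "fst ` (\<Union>x\<in>escape_set u v. nbr x)"] unfolding bdd_below_def
    by (metis finite_imageI image_eqI)
  obtain n where n: "n < n0" "barrier R n u" using bar by blast
  \<comment> \<open>Sites whose connection to \<open>v\<close> has never met \<open>\<Lambda>\<close>, or last met it above the barrier.\<close>
  define C where "C = escape_set u v \<union> (\<Union>z\<in>{n<..<0} \<times> \<Lambda>. escape_set u z)"
  have "last (v # xs) \<in> C" if "walk v xs" "\<forall>s\<in>set xs. is_open 0 u s" for xs
    using that
  proof (induction xs rule: rev_induct)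
    case Nil
    then show ?case by (simp add: C_def escape_set_refl)
  next
    case (snoc x xs)
    let ?y = "last (v # xs)"
    have x: "x \<in> nbr ?y" "is_open 0 u x" "?y \<in> C"
      using snoc by (auto simp: walk_append simp del: last.simps)
    have "x \<in> C"
    proof (cases "snd x \<in> \<Lambda>")
      case False
      then show ?thesis using x escape_set_step unfolding C_def by blast
    next
      case True
      have "n < fst x"
      proof (cases "?y \<in> escape_set u v")
        case True
        then show ?thesis using n0[of x] n x(1) by fastforce
      next
        case False
        then obtain z where "z \<in> {n<..<0} \<times> \<Lambda>" "?y \<in> escape_set u z"
          using x(3) unfolding C_def by blast
        then show ?thesis
          using barrier_blocks[OF n(2) _ _ _ _ x(1,2) True] by (auto simp: mem_Times_iff)
      qed
      then have "x \<in> {n<..<0} \<times> \<Lambda>" using True x(2) by (auto simp: is_open_def mem_Times_iff)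
      then show ?thesis using escape_set_refl unfolding C_def by blast
    qed
    then show ?case by simp
  qed
  then have "cluster 0 u v \<subseteq> C" by (auto simp: cluster_def simp del: last.simps)
  moreover have "finite C"
    using fin v \<Lambda>_finite \<Lambda>_sub unfolding C_def by auto
  ultimately show ?thesis by (rule finite_subset)
qed


section \<open>Long paths off the exceptional columns are unlikely\<close>

definition cyl :: "(int \<times> nat) set \<Rightarrow> (int \<times> nat) set \<Rightarrow> (int \<times> nat \<Rightarrow> real) set"
  where "cyl S B = {u \<in> space color_space. (\<forall>s\<in>S. is_open 0 u s) \<and> (\<forall>s\<in>B. \<not> is_open 0 u s)}"

lemma is_open_0_iff: "s \<in> sites \<Longrightarrow> is_open 0 u s \<longleftrightarrow> t (snd s) \<le> u s"
  by (auto simp: is_open_def sites_def)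

lemma prob_cyl:
  assumes "finite S" "finite B" "S \<subseteq> sites" "B \<subseteq> sites" "S \<inter> B = {}"
  shows "color_space.prob (cyl S B) = (\<Prod>s\<in>S. 1 - t (snd s)) * (\<Prod>s\<in>B. t (snd s))"
proof -
  have "cyl S B = {u \<in> space color_space. (\<forall>s\<in>S. t (snd s) \<le> u s) \<and> (\<forall>s\<in>B. u s < t (snd s))}"
    using assms is_open_0_iff unfolding cyl_def by (auto simp: not_le subset_iff)
  moreover have "0 \<le> t (snd s) \<and> t (snd s) \<le> 1" if "s \<in> S \<union> B" for s
    using that assms t_pos[of "snd s"] t_le1[of "snd s"] by (auto simp: sites_def)
  ultimately show ?thesis
    using prob_threshold_cylinder[of S B "\<lambda>s. t (snd s)"] assms sites_color_index by auto
qed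

lemma pred_is_open:
  assumes "\<And>s. s \<in> sites \<Longrightarrow> fst s < - int m \<Longrightarrow> Measurable.pred M (\<lambda>u. t (snd s) \<le> u s)"
  shows "Measurable.pred M (\<lambda>u. is_open m u s)"
proof (cases "fst s < - int m \<and> snd s \<in> K")
  case True
  then show ?thesis
    using assms[of s] by (auto simp: is_open_def sites_def mem_Times_iff)
qed (auto simp: is_open_def)

lemma pred_threshold: "s \<in> sites \<Longrightarrow> Measurable.pred color_space (\<lambda>u. t (snd s) \<le> u s)"
proof -
  assume "s \<in> sites"
  then have [measurable]: "(\<lambda>u. u s) \<in> borel_measurable color_space"
    using measurable_color_coordinate sites_color_index by blast
  show ?thesis by measurable
qed

lemma pred_is_open_color [measurable]: "Measurable.pred color_space (\<lambda>u. is_open m u s)"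
  by (intro pred_is_open pred_threshold)

lemma pred_escape_path [measurable]: "Measurable.pred color_space (\<lambda>u. escape_path u z xs)"
  unfolding escape_path_def by measurable

lemma pred_barrier [measurable]: "Measurable.pred color_space (barrier R n)"
  unfolding barrier_def by measurable

lemma sets_cyl [measurable]: "cyl S B \<in> sets color_space"
  unfolding cyl_def by measurable

lemma cyl_subset: "cyl S B \<subseteq> space color_space"
  by (auto simp: cyl_def)

lemma sets_escape:
  "{u \<in> cyl S B. \<exists>xs. length xs = L \<and> set xs \<inter> S = {} \<and> escape_path u z xs} \<in> sets color_space"
proof -
  have "{u \<in> cyl S B. \<exists>xs. length xs = L \<and> set xs \<inter> S = {} \<and> escape_path u z xs}
      = cyl S B \<inter> {u \<in> space color_space. \<exists>xs. length xs = L \<and> set xs \<inter> S = {} \<and> escape_path u z xs}"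
    using cyl_subset by auto
  also have "\<dots> \<in> sets color_space" by measurable
  finally show ?thesis .
qed

text \<open>Union bound over the first step. Recording the sites already used in \<open>S\<close> makes the path
  self-avoiding, so that each step inspects a new coordinate and costs an independent factor; summed
  over the neighbours these factors give \<open>weight\<close>, which is at most \<open>\<delta>\<close> from the second step on. The
  closed set \<open>B\<close> stays in the statement so that the bound also holds jointly with the closed block of a
  barrier, which no path off \<open>\<Lambda>\<close> inspects.\<close>

lemma prob_escape_le:
  assumes B: "finite B" "B \<subseteq> {..<0} \<times> \<Lambda>"
    and "snd z \<in> K" "finite S" "S \<subseteq> sites" "S \<inter> B = {}"
  shows "color_space.prob {u \<in> cyl S B. \<exists>xs. length xs = L \<and> set xs \<inter> S = {} \<and> escape_path u z xs}
    \<le> color_space.prob (cyl S B) * (if L = 0 then 1 else weight (snd z) * \<delta> ^ (L - 1))"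
  using assms(3-)
proof (induction L arbitrary: z S)
  case 0
  then show ?case by (auto intro!: color_space.finite_measure_mono)
next
  case (Suc L)
  let ?E = "\<lambda>L z S. {u \<in> cyl S B. \<exists>xs. length xs = L \<and> set xs \<inter> S = {} \<and> escape_path u z xs}"
  let ?p = "color_space.prob (cyl S B)"
  define Y where "Y = {y \<in> nbr z. y \<in> sites \<and> snd y \<notin> \<Lambda> \<and> y \<notin> S}"
  have Bsites: "B \<subseteq> sites" using B \<Lambda>_sub by (auto simp: sites_def)
  have Yfin: "finite Y" using Suc.prems finite_nbr by (simp add: Y_def)
  have "?E (Suc L) z S \<subseteq> (\<Union>y\<in>Y. ?E L y (insert y S))"
  proof
    fix u assume "u \<in> ?E (Suc L) z S"
    then obtain y ys where y: "length ys = L" "u \<in> cyl S B" "set (y # ys) \<inter> S = {}"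
      "escape_path u z (y # ys)"
      by (auto simp: length_Suc_conv)
    then have "y \<in> Y" "is_open 0 u y"
      by (auto simp: Y_def escape_path_def is_open_sites)
    moreover from this y have "u \<in> ?E L y (insert y S)"
      by (auto simp: cyl_def escape_path_def)
    ultimately show "u \<in> (\<Union>y\<in>Y. ?E L y (insert y S))" by blast
  qed
  then have "color_space.prob (?E (Suc L) z S) \<le> color_space.prob (\<Union>y\<in>Y. ?E L y (insert y S))"
    by (intro color_space.finite_measure_mono sets.finite_UN Yfin sets_escape)
  also have "\<dots> \<le> (\<Sum>y\<in>Y. color_space.prob (?E L y (insert y S)))"
    by (intro color_space.finite_measure_subadditive_finite Yfin) (auto intro: sets_escape)
  also have "\<dots> \<le> (\<Sum>y\<in>Y. (1 - t (snd y)) * (?p * \<delta> ^ L))"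
  proof (rule sum_mono)
    fix y assume y: "y \<in> Y"
    then have K: "snd y \<in> K" "snd y \<notin> \<Lambda>" "y \<notin> S" "y \<notin> B" "y \<in> sites"
      using B by (auto simp: Y_def sites_def)
    have "(if L = 0 then 1 else weight (snd y) * \<delta> ^ (L - 1)) \<le> \<delta> ^ L"
      using subcritical[of "snd y"] K \<delta>_nonneg
      by (cases L) (auto simp: weight_def intro!: mult_right_mono)
    moreover have "color_space.prob (cyl (insert y S) B) = (1 - t (snd y)) * ?p"
      using K Suc.prems B Bsites by (subst (1 2) prob_cyl) auto
    moreover have "color_space.prob (?E L y (insert y S)) \<le> color_space.prob (cyl (insert y S) B)
        * (if L = 0 then 1 else weight (snd y) * \<delta> ^ (L - 1))"
      using K Suc.prems by (intro Suc.IH) auto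
    moreover have "color_space.prob (cyl (insert y S) B)
        * (if L = 0 then 1 else weight (snd y) * \<delta> ^ (L - 1))
      \<le> color_space.prob (cyl (insert y S) B) * \<delta> ^ L"
      using calculation(1) by (intro mult_left_mono) auto
    ultimately show "color_space.prob (?E L y (insert y S)) \<le> (1 - t (snd y)) * (?p * \<delta> ^ L)"
      by (simp add: mult.assoc)
  qed
  also have "\<dots> = (\<Sum>y\<in>Y. 1 - t (snd y)) * (?p * \<delta> ^ L)"
    by (simp add: sum_distrib_right)
  also have "\<dots> \<le> weight (snd z) * (?p * \<delta> ^ L)"
  proof (rule mult_right_mono)
    have "(\<Sum>y\<in>Y. 1 - t (snd y)) \<le> (\<Sum>y\<in>nbr z. 1 - t (snd y))"
      using Suc.prems finite_nbr nbr_K one_minus_t_nonneg by (intro sum_mono2) (auto simp: Y_def)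
    then show "(\<Sum>y\<in>Y. 1 - t (snd y)) \<le> weight (snd z)"
      using sum_nbr_le_weight[of z] Suc.prems by linarith
  qed (simp add: \<delta>_nonneg)
  finally show ?case by (simp add: algebra_simps)
qed

lemma AE_escape_paths_bounded:
  "AE u in color_space. \<forall>z. snd z \<in> K \<longrightarrow> (\<exists>L. \<nexists>xs. length xs = L \<and> escape_path u z xs)"
  unfolding AE_all_countable
proof
  fix z
  show "AE u in color_space. snd z \<in> K \<longrightarrow> (\<exists>L. \<nexists>xs. length xs = L \<and> escape_path u z xs)"
  proof (cases "snd z \<in> K")
    case True
    define X where "X = {u \<in> space color_space. \<forall>L. \<exists>xs. length xs = L \<and> escape_path u z xs}"
    have X: "X \<in> sets color_space" unfolding X_def by measurable
    have cyl: "cyl {} {} = space color_space" by (simp add: cyl_def)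
    have le: "color_space.prob X \<le> weight (snd z) * \<delta> ^ L" for L
    proof -
      have "color_space.prob X \<le> color_space.prob
          {u \<in> cyl {} {}. \<exists>xs. length xs = Suc L \<and> set xs \<inter> {} = {} \<and> escape_path u z xs}"
        by (intro color_space.finite_measure_mono sets_escape) (auto simp: X_def cyl)
      also have "\<dots> \<le> weight (snd z) * \<delta> ^ L"
        using prob_escape_le[of "{}" z "{}" "Suc L"] True by (simp add: cyl color_space.prob_space)
      finally show ?thesis .
    qed
    have "(\<lambda>L. weight (snd z) * \<delta> ^ L) \<longlonglongrightarrow> weight (snd z) * 0"
      using \<delta>_nonneg \<delta>_less1 by (intro tendsto_mult tendsto_const LIMSEQ_power_zero) auto
    then have "color_space.prob X \<le> weight (snd z) * 0"
      using le by (intro LIMSEQ_le_const) auto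
    then have "X \<in> null_sets color_space"
      using X measure_nonneg[of color_space X]
      by (auto simp: null_sets_def color_space.emeasure_eq_measure)
    then show ?thesis by (rule AE_I') (auto simp: X_def)
  qed simp
qed

section \<open>Barriers have probability bounded away from zero\<close>

lemma sum_escape_levels_le:
  assumes "n < 0"
  shows "(\<Sum>m\<in>{n<..<0}. \<delta> ^ (nat (m - n) + R - 1)) \<le> \<delta> ^ R / (1 - \<delta>)"
proof -
  have "(\<Sum>m\<in>{n<..<0}. \<delta> ^ (nat (m - n) + R - 1)) = (\<Sum>j<nat (- 1 - n). \<delta> ^ j * \<delta> ^ R)"
    by (rule sum.reindex_bij_witness[of _ "\<lambda>j. n + 1 + int j" "\<lambda>m. nat (m - n - 1)"])
      (auto simp: power_add[symmetric] nat_diff_distrib intro!: arg_cong[of _ _ "power \<delta>"])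
  also have "\<dots> = (\<Sum>j<nat (- 1 - n). \<delta> ^ j) * \<delta> ^ R"
    by (simp add: sum_distrib_right)
  also have "\<dots> \<le> (1 / (1 - \<delta>)) * \<delta> ^ R"
  proof (rule mult_right_mono)
    show "(\<Sum>j<nat (- 1 - n). \<delta> ^ j) \<le> 1 / (1 - \<delta>)"
      using sum_le_suminf[of "\<lambda>j. \<delta> ^ j" "{..<nat (- 1 - n)}"] \<delta>_nonneg \<delta>_less1
        geometric_sums[of \<delta>] by (simp add: sums_iff)
  qed (simp add: \<delta>_nonneg)
  finally show ?thesis by simp
qed

text \<open>The closed block has a positive probability \<open>b\<close> independent of its height. Given that block, the
  expected number of bypassing paths is at most a constant times \<open>\<delta>\<^sup>R / (1 - \<delta>)\<close>, because a start at
  height \<open>m\<close> needs \<open>m - n + R\<close> steps. For \<open>R\<close> large this is at most \<open>1/2\<close>, which leaves probability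
  \<open>b / 2\<close> for a barrier.\<close>

lemma barrier_probability_bounded_below:
  obtains R c where "c > 0" "\<And>n. n < 0 \<Longrightarrow> c \<le> color_space.prob {u \<in> space color_space. barrier R n u}"
proof -
  define W where "W = (\<Sum>k\<in>\<Lambda>. weight k)"
  have "(\<lambda>R. W * (\<delta> ^ R / (1 - \<delta>))) \<longlonglongrightarrow> W * (0 / (1 - \<delta>))"
    using \<delta>_nonneg \<delta>_less1 by (intro tendsto_intros LIMSEQ_power_zero) auto
  then have "\<forall>\<^sub>F R in sequentially. W * (\<delta> ^ R / (1 - \<delta>)) < 1 / 2"
    by (intro order_tendstoD(2)[of _ "W * (0 / (1 - \<delta>))"]) auto
  then obtain R where R: "W * (\<delta> ^ R / (1 - \<delta>)) < 1 / 2"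
    by (auto simp: eventually_sequentially)
  define b where "b = (\<Prod>k\<in>\<Lambda>. t k) ^ (R + 1)"
  have b: "b > 0" unfolding b_def using t_pos \<Lambda>_sub by (intro zero_less_power prod_pos) auto
  have "b / 2 \<le> color_space.prob {u \<in> space color_space. barrier R n u}" if n: "n < 0" for n
  proof -
    let ?B = "{n - int R..n} \<times> \<Lambda>" and ?I = "{n<..<0} \<times> \<Lambda>"
    let ?E = "\<lambda>s. {u \<in> cyl {} ?B. \<exists>xs. length xs = nat (fst s - n) + R \<and> set xs \<inter> {} = {} \<and> escape_path u s xs}"
    have fin: "finite ?I" "finite ?B" using \<Lambda>_finite by auto
    have B: "?B \<subseteq> {..<0} \<times> \<Lambda>" "?B \<subseteq> sites" using n \<Lambda>_sub by (auto simp: sites_def)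
    have pb: "color_space.prob (cyl {} ?B) = b"
    proof -
      have "color_space.prob (cyl {} ?B) = (\<Prod>(i, k)\<in>?B. t k)"
        using fin B by (subst prob_cyl) (auto simp: split_def)
      also have "\<dots> = (\<Prod>i\<in>{n - int R..n}. \<Prod>k\<in>\<Lambda>. t k)"
        by (rule prod.cartesian_product[symmetric])
      finally show ?thesis by (simp add: b_def nat_add_distrib)
    qed
    have "cyl {} ?B \<subseteq> {u \<in> space color_space. barrier R n u} \<union> (\<Union>s\<in>?I. ?E s)"
      by (auto simp: cyl_def barrier_def)
    then have "b \<le> color_space.prob ({u \<in> space color_space. barrier R n u} \<union> (\<Union>s\<in>?I. ?E s))"
      unfolding pb[symmetric] using fin
      by (intro color_space.finite_measure_mono sets.Un sets.finite_UN sets_escape) auto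
    also have "\<dots> \<le> color_space.prob {u \<in> space color_space. barrier R n u}
        + color_space.prob (\<Union>s\<in>?I. ?E s)"
      using fin by (intro measure_Un_le sets.finite_UN sets_escape) auto
    also have "color_space.prob (\<Union>s\<in>?I. ?E s) \<le> (\<Sum>s\<in>?I. color_space.prob (?E s))"
      using fin by (intro color_space.finite_measure_subadditive_finite) (auto intro: sets_escape)
    also have "\<dots> \<le> (\<Sum>s\<in>?I. b * (weight (snd s) * \<delta> ^ (nat (fst s - n) + R - 1)))"
    proof (rule sum_mono)
      fix s assume s: "s \<in> ?I"
      show "color_space.prob (?E s) \<le> b * (weight (snd s) * \<delta> ^ (nat (fst s - n) + R - 1))"
        using prob_escape_le[of ?B s "{}" "nat (fst s - n) + R"] fin B s \<Lambda>_sub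
        by (auto simp: pb split: if_splits)
    qed
    also have "\<dots> = (\<Sum>(m, k)\<in>?I. (b * \<delta> ^ (nat (m - n) + R - 1)) * weight k)"
      by (simp add: split_def algebra_simps)
    also have "\<dots> = (\<Sum>m\<in>{n<..<0}. \<Sum>k\<in>\<Lambda>. (b * \<delta> ^ (nat (m - n) + R - 1)) * weight k)"
      by (rule sum.cartesian_product[symmetric])
    also have "\<dots> = b * (W * (\<Sum>m\<in>{n<..<0}. \<delta> ^ (nat (m - n) + R - 1)))"
      by (simp add: W_def sum_distrib_left sum_distrib_right sum.swap[of _ \<Lambda>] algebra_simps)
    also have "\<dots> \<le> b * (W * (\<delta> ^ R / (1 - \<delta>)))"
      using b sum_escape_levels_le[OF n] weight_nonneg \<Lambda>_sub
      by (intro mult_left_mono) (auto simp: W_def intro: sum_nonneg)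
    also have "\<dots> \<le> b * (1 / 2)"
      using b R by (intro mult_left_mono) auto
    finally show ?thesis by simp
  qed
  then show thesis using that[of "b / 2" R] b by simp
qed

section \<open>The zero-one law for infinite clusters\<close>

definition has_infinite_cluster :: "nat \<Rightarrow> (int \<times> nat \<Rightarrow> real) \<Rightarrow> bool"
  where "has_infinite_cluster m u \<longleftrightarrow> (\<exists>v. snd v \<in> K \<and> infinite (cluster m u v))"

text \<open>Measurability is needed for an arbitrary \<open>\<sigma>\<close>-algebra on which the sites below height \<open>-m\<close> are
  measurable: applied to the one that these sites generate, it yields tail events.\<close>

lemma pred_has_infinite_cluster:
  assumes "\<And>s. s \<in> sites \<Longrightarrow> fst s < - int m \<Longrightarrow> Measurable.pred M (\<lambda>u. t (snd s) \<le> u s)"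
  shows "Measurable.pred M (has_infinite_cluster m)"
proof -
  note pred_is_open[OF assms, measurable]
  have "has_infinite_cluster m u \<longleftrightarrow> (\<exists>v. snd v \<in> K \<and> (\<forall>n. \<exists>y. n < to_nat y \<and>
      (\<exists>xs. walk v xs \<and> last (v # xs) = y \<and> (\<forall>s\<in>set xs. is_open m u s))))" for u
  proof -
    have "infinite A \<longleftrightarrow> (\<forall>n. \<exists>y. n < to_nat y \<and> y \<in> A)" for A :: "(int \<times> nat) set"
    proof -
      have "infinite A \<longleftrightarrow> infinite (to_nat ` A)"
        by (simp add: finite_image_iff)
      then show ?thesis unfolding infinite_nat_iff_unbounded by blast
    qed
    then show ?thesis
      unfolding has_infinite_cluster_def cluster_def by (simp del: last.simps) metis
  qed
  then have eq: "has_infinite_cluster m = (\<lambda>u. \<exists>v. snd v \<in> K \<and> (\<forall>n. \<exists>y. n < to_nat y \<and>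
      (\<exists>xs. walk v xs \<and> last (v # xs) = y \<and> (\<forall>s\<in>set xs. is_open m u s))))" by (intro ext)
  show ?thesis unfolding eq by measurable
qed

lemma pred_has_infinite_cluster_color [measurable]:
  "Measurable.pred color_space (has_infinite_cluster m)"
  by (intro pred_has_infinite_cluster pred_threshold)

lemma has_infinite_cluster_antimono:
  "m \<le> m' \<Longrightarrow> has_infinite_cluster m' u \<Longrightarrow> has_infinite_cluster m u"
proof -
  assume "m \<le> m'"
  then have "cluster m' u v \<subseteq> cluster m u v" for v
    by (fastforce simp: cluster_def is_open_def simp del: last.simps)
  then show "has_infinite_cluster m' u \<Longrightarrow> has_infinite_cluster m u"
    unfolding has_infinite_cluster_def by (meson finite_subset)
qed

text \<open>The events \<open>F N\<close> that some barrier lies below height \<open>-N\<close> decrease and all have probability at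
  least \<open>c\<close>. So with probability at least \<open>c\<close> there are barriers arbitrarily far down, and then
  \<open>finite_cluster\<close> applies.\<close>

lemma prob_infinite_cluster_less_1:
  "color_space.prob {u \<in> space color_space. has_infinite_cluster 0 u} < 1"
proof -
  obtain R c where c: "c > 0"
    and bar: "\<And>n. n < 0 \<Longrightarrow> c \<le> color_space.prob {u \<in> space color_space. barrier R n u}"
    using barrier_probability_bounded_below by blast
  define F where "F N = {u \<in> space color_space. \<exists>n < - int N. barrier R n u}" for N
  have F: "F N \<in> sets color_space" for N unfolding F_def by measurable
  have F_mono: "F N' \<subseteq> F N" if "N \<le> N'" for N N'
  proof
    fix u assume "u \<in> F N'"
    then obtain n where "n < - int N'" "barrier R n u" "u \<in> space color_space"
      by (auto simp: F_def)
    moreover from this that have "n < - int N" by linarith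
    ultimately show "u \<in> F N" by (auto simp: F_def)
  qed
  have "c \<le> color_space.prob (F N)" for N
  proof -
    have "- int N - 1 < - int N" by simp
    then have "{u \<in> space color_space. barrier R (- int N - 1) u} \<subseteq> F N"
      unfolding F_def by blast
    then have "color_space.prob {u \<in> space color_space. barrier R (- int N - 1) u}
        \<le> color_space.prob (F N)"
      by (rule color_space.finite_measure_mono[OF _ F])
    moreover have "c \<le> color_space.prob {u \<in> space color_space. barrier R (- int N - 1) u}"
      by (rule bar) simp
    ultimately show ?thesis by linarith
  qed
  moreover have "(\<lambda>N. color_space.prob (F N)) \<longlonglongrightarrow> color_space.prob (\<Inter>N. F N)"
  proof (rule color_space.finite_Lim_measure_decseq)
    show "decseq F" using F_mono unfolding decseq_def by blast
  qed (use F in blast)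
  ultimately have le: "c \<le> color_space.prob (\<Inter>N. F N)"
    by (intro LIMSEQ_le_const) auto
  have "AE u in color_space. u \<in> {u \<in> space color_space. has_infinite_cluster 0 u}
      \<longrightarrow> u \<in> space color_space - (\<Inter>N. F N)"
    using AE_escape_paths_bounded
  proof eventually_elim
    fix u
    assume esc: "\<forall>z. snd z \<in> K \<longrightarrow> (\<exists>L. \<nexists>xs. length xs = L \<and> escape_path u z xs)"
    have "\<not> has_infinite_cluster 0 u" if "u \<in> (\<Inter>N. F N)"
    proof -
      have "\<exists>n<n0. barrier R n u" for n0
      proof -
        have "u \<in> F (nat (- n0))" using that by blast
        then obtain n where "n < - int (nat (- n0))" "barrier R n u" by (auto simp: F_def)
        moreover have "- int (nat (- n0)) \<le> n0" by simp
        ultimately show ?thesis by (intro exI[of _ n]) linarith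
      qed
      then show ?thesis using finite_cluster esc unfolding has_infinite_cluster_def by metis
    qed
    then show "u \<in> {u \<in> space color_space. has_infinite_cluster 0 u}
      \<longrightarrow> u \<in> space color_space - (\<Inter>N. F N)" by blast
  qed
  then have "color_space.prob {u \<in> space color_space. has_infinite_cluster 0 u}
      \<le> color_space.prob (space color_space - (\<Inter>N. F N))"
    using F by (intro color_space.finite_measure_mono_AE) auto
  also have "\<dots> = 1 - color_space.prob (\<Inter>N. F N)"
    using F by (intro color_space.prob_compl) auto
  finally show ?thesis using le c by linarith
qed

text \<open>Shifting all heights by \<open>m\<close> preserves the product measure and carries the sites below \<open>0\<close> to those
  below \<open>-m\<close>.\<close>

lemma prob_infinite_cluster_shift:
  "color_space.prob {u \<in> space color_space. has_infinite_cluster m u}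
    = color_space.prob {u \<in> space color_space. has_infinite_cluster 0 u}"
proof -
  define \<phi> :: "int \<times> nat \<Rightarrow> int \<times> nat" where "\<phi> s = (fst s - int m, snd s)" for s
  define shift where "shift u = (\<lambda>s\<in>color_index. u (\<phi> s))" for u :: "int \<times> nat \<Rightarrow> real"
  have inj: "inj \<phi>" by (auto simp: \<phi>_def inj_on_def prod_eq_iff)
  have surj: "\<exists>s. x = \<phi> s" for x
    by (rule exI[of _ "(fst x + int m, snd x)"]) (simp add: \<phi>_def)
  have \<phi>_index: "\<phi> \<in> color_index \<rightarrow> color_index" by (auto simp: \<phi>_def color_index_def)
  have distr: "distr color_space color_space shift = color_space"
    unfolding color_space_def shift_def
    using distr_PiM_reindex[of color_index "\<lambda>_. restrict_space lborel {0..1::real}" \<phi> color_index]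
      inj_on_subset[OF inj] \<phi>_index prob_space_unit_interval by auto
  have meas: "shift \<in> measurable color_space color_space"
    unfolding color_space_def shift_def using \<phi>_index
    by (intro measurable_restrict measurable_component_singleton) auto
  have op: "is_open m u (\<phi> s) \<longleftrightarrow> is_open 0 (shift u) s" for u s
  proof (cases "s \<in> sites")
    case True
    then show ?thesis
      using sites_color_index by (auto simp: is_open_def shift_def \<phi>_def)
  next
    case False
    then show ?thesis by (auto simp: is_open_def \<phi>_def sites_def mem_Times_iff)
  qed
  have nbr: "\<phi> x \<in> nbr (\<phi> z) \<longleftrightarrow> x \<in> nbr z" for x z
    by (cases x; cases z) (auto simp: nbr_def \<phi>_def)
  have walk: "walk (\<phi> z) (map \<phi> xs) \<longleftrightarrow> walk z xs" for z xs
    by (induction xs arbitrary: z) (auto simp: nbr)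
  have lists: "\<exists>ys. xs = map \<phi> ys" for xs
    using surj by (metis ex_map_conv)
  have cl: "cluster m u (\<phi> v) = \<phi> ` cluster 0 (shift u) v" for u v
  proof -
    have last: "last (\<phi> v # map \<phi> ys) = \<phi> (last (v # ys))" for ys
      using last_map[of "v # ys" \<phi>] by simp
    show ?thesis
    proof (intro equalityI subsetI)
      fix x assume "x \<in> cluster m u (\<phi> v)"
      then obtain xs where xs: "walk (\<phi> v) xs" "\<forall>s\<in>set xs. is_open m u s" "x = last (\<phi> v # xs)"
        unfolding cluster_def by blast
      moreover obtain ys where "xs = map \<phi> ys" using lists by blast
      ultimately have "walk v ys" "\<forall>s\<in>set ys. is_open 0 (shift u) s" "x = \<phi> (last (v # ys))"
        by (simp_all add: walk op last del: last.simps)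
      then show "x \<in> \<phi> ` cluster 0 (shift u) v" unfolding cluster_def by blast
    next
      fix x assume "x \<in> \<phi> ` cluster 0 (shift u) v"
      then obtain ys where ys: "walk v ys" "\<forall>s\<in>set ys. is_open 0 (shift u) s" "x = \<phi> (last (v # ys))"
        unfolding cluster_def by blast
      then have "walk (\<phi> v) (map \<phi> ys)" "\<forall>s\<in>set (map \<phi> ys). is_open m u s"
        "x = last (\<phi> v # map \<phi> ys)"
        by (simp_all add: walk op last del: last.simps)
      then show "x \<in> cluster m u (\<phi> v)" unfolding cluster_def by blast
    qed
  qed
  have ev: "has_infinite_cluster m u \<longleftrightarrow> has_infinite_cluster 0 (shift u)" for u
  proof -
    have "snd (\<phi> v) = snd v" for v by (simp add: \<phi>_def)
    moreover have "infinite (cluster m u (\<phi> v)) \<longleftrightarrow> infinite (cluster 0 (shift u) v)" for v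
      unfolding cl by (simp add: finite_image_iff inj_on_subset[OF inj])
    ultimately show ?thesis unfolding has_infinite_cluster_def using surj by metis
  qed
  have "color_space.prob {u \<in> space color_space. has_infinite_cluster 0 u}
      = measure (distr color_space color_space shift) {u \<in> space color_space. has_infinite_cluster 0 u}"
    by (simp add: distr)
  also have "\<dots> = color_space.prob (shift -` {u \<in> space color_space. has_infinite_cluster 0 u} \<inter> space color_space)"
    by (intro measure_distr meas) measurable
  also have "shift -` {u \<in> space color_space. has_infinite_cluster 0 u} \<inter> space color_space
      = {u \<in> space color_space. has_infinite_cluster m u}"
    using measurable_space[OF meas] by (auto simp: ev)
  finally show ?thesis by simp
qed

lemma indep_open_events:
  "color_space.indep_events (\<lambda>s. {u \<in> space color_space. t (snd s) \<le> u s}) sites"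
proof (rule color_space.indep_eventsI)
  fix s assume "s \<in> sites"
  then show "{u \<in> space color_space. t (snd s) \<le> u s} \<in> sets color_space"
    using pred_threshold by simp
next
  fix J assume J: "J \<subseteq> sites" "finite J" "J \<noteq> {}"
  have *: "(\<Inter>s\<in>I. {u \<in> space color_space. t (snd s) \<le> u s}) = cyl I {}" if "I \<subseteq> sites" "I \<noteq> {}" for I
  proof -
    have "\<And>s u. s \<in> I \<Longrightarrow> is_open 0 u s \<longleftrightarrow> t (snd s) \<le> u s"
      using that is_open_0_iff by blast
    then show ?thesis using that by (auto simp: cyl_def simp del: split_paired_All)
  qed
  have "color_space.prob {u \<in> space color_space. t (snd s) \<le> u s} = 1 - t (snd s)" if "s \<in> J" for s
    using *[of "{s}"] prob_cyl[of "{s}" "{}"] J that by auto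
  then show "color_space.prob (\<Inter>s\<in>J. {u \<in> space color_space. t (snd s) \<le> u s})
      = (\<Prod>s\<in>J. color_space.prob {u \<in> space color_space. t (snd s) \<le> u s})"
    using *[OF J(1,3)] prob_cyl[of J "{}"] J by simp
qed

text \<open>The tail is taken along the levels: \<open>A j\<close> is generated by the sites at height \<open>-1 - j\<close>.\<close>

theorem AE_finite_clusters:
  "AE u in color_space. \<forall>v. snd v \<in> K \<longrightarrow> finite (cluster 0 u v)"
proof -
  let ?I = "\<lambda>m. {u \<in> space color_space. has_infinite_cluster m u}"
  let ?ev = "\<lambda>s. {u \<in> space color_space. t (snd s) \<le> u s}"
  define lev where "lev j = {s \<in> sites. fst s = - 1 - int j}" for j
  define A where "A j = sigma_sets (space color_space) (\<Union>s\<in>lev j. {?ev s})" for j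
  define X where "X = (\<Inter>m. ?I m)"
  have indep: "color_space.indep_sets A UNIV"
    unfolding A_def
  proof (rule color_space.indep_sets_collect_sigma)
    have "(\<Union>j\<in>UNIV. lev j) \<subseteq> sites" by (auto simp: lev_def)
    then show "color_space.indep_sets (\<lambda>s. {?ev s}) (\<Union>j\<in>UNIV. lev j)"
      using indep_open_events unfolding color_space.indep_events_def_alt
      by (rule color_space.indep_sets_mono_index)
  qed (auto simp: Int_stable_def disjoint_family_on_def lev_def)
  have A_sub: "A j \<subseteq> Pow (space color_space)" for j
    unfolding A_def by (rule subsetI, drule sigma_sets_into_sp[rotated]) auto
  have "X \<in> color_space.tail_events A"
    unfolding color_space.tail_events_def
  proof
    fix n
    define M where "M = sigma (space color_space) (\<Union> (A ` {n..}))"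
    have sub: "\<Union> (A ` {n..}) \<subseteq> Pow (space color_space)" using A_sub by auto
    have sets: "sets M = sigma_sets (space color_space) (\<Union> (A ` {n..}))"
      and space: "space M = space color_space"
      using sub by (auto simp: M_def)
    \<comment> \<open>As \<open>X\<close> is a decreasing intersection, the cutoffs below \<open>n\<close> may be dropped; the remaining
      events see no level before \<open>n\<close>.\<close>
    have "Measurable.pred M (has_infinite_cluster (n + i))" for i
    proof (rule pred_has_infinite_cluster)
      fix s assume s: "s \<in> sites" "fst s < - int (n + i)"
      have "s \<in> lev (nat (- 1 - fst s))" using s by (auto simp: lev_def)
      then have "?ev s \<in> A (nat (- 1 - fst s))" unfolding A_def by auto
      moreover have "n \<le> nat (- 1 - fst s)" using s by auto
      ultimately have "?ev s \<in> sets M" unfolding sets by auto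
      then show "Measurable.pred M (\<lambda>u. t (snd s) \<le> u s)"
        by (simp add: pred_def space)
    qed
    then have "{u \<in> space M. \<forall>i. has_infinite_cluster (n + i) u} \<in> sets M"
      by measurable
    also have "{u \<in> space M. \<forall>i. has_infinite_cluster (n + i) u} = X"
    proof -
      have "(\<forall>i. has_infinite_cluster (n + i) u) \<longleftrightarrow> (\<forall>m. has_infinite_cluster m u)" for u
        by (meson has_infinite_cluster_antimono le_add2)
      then show ?thesis unfolding X_def space by auto
    qed
    finally show "X \<in> sigma_sets (space color_space) (\<Union> (A ` {n..}))" unfolding sets .
  qed
  moreover have "sigma_algebra (space color_space) (A j)" for j
    unfolding A_def by (intro sigma_algebra_sigma_sets) auto
  ultimately have zero_one: "color_space.prob X = 0 \<or> color_space.prob X = 1"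
    using color_space.kolmogorov_0_1_law indep by blast
  have "(\<lambda>m. color_space.prob (?I m)) \<longlonglongrightarrow> color_space.prob X"
    unfolding X_def using has_infinite_cluster_antimono
    by (intro color_space.finite_Lim_measure_decseq) (auto simp: decseq_def)
  then have "(\<lambda>m. color_space.prob (?I 0)) \<longlonglongrightarrow> color_space.prob X"
    by (subst (asm) prob_infinite_cluster_shift)
  then have "color_space.prob (?I 0) = color_space.prob X"
    using tendsto_const by (rule LIMSEQ_unique[rotated])
  then have "color_space.prob (?I 0) = 0"
    using zero_one prob_infinite_cluster_less_1 by auto
  then have "?I 0 \<in> null_sets color_space"
    by (auto simp: null_sets_def color_space.emeasure_eq_measure)
  then show ?thesis by (rule AE_I') (auto simp: has_infinite_cluster_def)
qed

end

section \<open>Top-dimensional cells of the prism tessellation\<close>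

text \<open>Without this, the top-dimensional cells of \<open>star_tess P\<close> could include slices \<open>{n} \<times> \<sigma>\<close> over cells
  \<open>\<sigma>\<close> one dimension too large, and adjacency there would not project to adjacency in \<open>P\<close>. The
  reason is invariance of dimension.\<close>

lemma tessellation_no_cells_above_dim:
  fixes P :: "nat \<Rightarrow> 'a::euclidean_space set set"
  assumes "polyhedral_tessellation TYPE('c::euclidean_space) P"
  shows "P (Suc DIM('a)) = {}"
proof (rule ccontr)
  assume "P (Suc DIM('a)) \<noteq> {}"
  then obtain \<sigma> where "\<sigma> \<in> P (Suc DIM('a))" by blast
  moreover have "\<forall>i. \<forall>\<sigma>\<in>P i. is_cell TYPE('c) i \<sigma>"
    using assms by (simp add: polyhedral_tessellation_def is_cell_polytope_def)
  ultimately have "is_cell TYPE('c) (Suc DIM('a)) \<sigma>" by blast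
  then obtain A :: "'c set" and f :: "'c \<Rightarrow> 'a" where "cell_chart (Suc DIM('a)) A f"
    unfolding is_cell_def by blast
  then have A: "convex A" "continuous_on A f" "inj_on f A" "aff_dim A = int (Suc DIM('a))"
    unfolding cell_chart_def by (auto intro: polyhedron_imp_convex)
  have "aff_dim A \<le> aff_dim (UNIV :: 'a set)"
    using A by (intro invariance_of_dimension_convex_domain[of A f]) auto
  then show False using A(4) by simp
qed

lemma edge_nonempty:
  assumes "polyhedral_tessellation TYPE('c::euclidean_space) P" "e \<in> P 1"
  shows "e \<noteq> {}"
proof -
  have "\<forall>i. \<forall>\<sigma>\<in>P i. is_cell TYPE('c) i \<sigma>"
    using assms by (simp add: polyhedral_tessellation_def is_cell_polytope_def)
  then have "is_cell TYPE('c) 1 e" using assms(2) by blast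
  then obtain A :: "'c set" and f where "aff_dim A = 1" "e = f ` A"
    unfolding is_cell_def cell_chart_def by auto
  then show ?thesis by auto
qed

lemma slices_in_common_cell:
  fixes P :: "nat \<Rightarrow> 'a::euclidean_space set set"
  assumes P: "polyhedral_tessellation TYPE('c::euclidean_space) P"
    and \<sigma>: "\<sigma> \<in> star_tess P DIM(real \<times> 'a)"
    and sub: "slice n e \<subseteq> \<sigma>" "slice m e' \<subseteq> \<sigma>" and ne: "e \<noteq> {}" "e' \<noteq> {}"
  shows "\<bar>n - m\<bar> \<le> 1" and "\<exists>\<tau>\<in>P DIM('a). e \<subseteq> \<tau> \<and> e' \<subseteq> \<tau>"
proof -
  obtain j \<tau> where \<tau>: "\<sigma> = prism j \<tau>" "\<tau> \<in> P DIM('a)"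
    using \<sigma> tessellation_no_cells_above_dim[OF P] by (auto simp: star_tess_def)
  have "e'' \<subseteq> \<tau> \<and> j \<le> i \<and> i \<le> j + 1" if "slice i e'' \<subseteq> \<sigma>" "e'' \<noteq> {}" for i e''
  proof -
    have "real_of_int j \<le> real_of_int i" "real_of_int i \<le> real_of_int (j + 1)" "e'' \<subseteq> \<tau>"
      using that unfolding \<tau> slice_def prism_def by auto
    then show ?thesis by linarith
  qed
  from this[OF sub(1) ne(1)] this[OF sub(2) ne(2)] \<tau>(2)
  show "\<bar>n - m\<bar> \<le> 1" "\<exists>\<tau>\<in>P DIM('a). e \<subseteq> \<tau> \<and> e' \<subseteq> \<tau>"
    by auto
qed

section \<open>Finiteness of the white clusters\<close>

theorem theorem7:
  fixes P :: "nat \<Rightarrow> 'a::euclidean_space set set"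
    and G :: "('a set, 'a set) multigraph"
    and p :: "'a set \<Rightarrow> real" and q :: real
    and en :: "nat \<Rightarrow> 'a set"
    and l :: ereal
  assumes "polyhedral_tessellation TYPE('c::euclidean_space) P"
    and "G = simplicial_graph P"
    and "\<And>e. e \<in> edges G \<Longrightarrow> 0 \<le> p e \<and> p e \<le> 1"
    and "q \<ge> 1"
    and "is_enumeration en (edges G)"
    and "\<And>e. e \<in> edges G \<Longrightarrow> p_hat p q e > 0"
    and "((\<lambda>\<Lambda>. SUP e\<in>edges G - \<Lambda>. ereal (g_hat P p q e)) \<longlongrightarrow> l)
           (finite_subsets_at_top (edges G))"
    and "l < 1"
  shows "\<forall>e\<in>edges G. AE u in color_space. finite (w_cluster_base P p q en u {e})"
proof
  note P = assms(1)
  have E: "edges G = P 1" using assms(2) by (simp add: simplicial_graph_def)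
  have p_hat: "0 < p_hat p q e" "p_hat p q e \<le> p e" "p e \<le> 1" if e: "e \<in> P 1" for e
  proof -
    show pos: "0 < p_hat p q e" using assms(6) e E by simp
    have p: "0 \<le> p e" "p e \<le> 1" using assms(3) e E by auto
    have "1 * (1 - p e) \<le> q * (1 - p e)"
      using assms(4) p by (intro mult_right_mono) auto
    then have "1 \<le> p e + q * (1 - p e)" by simp
    then show "p_hat p q e \<le> p e"
      using p mult_left_mono[of 1 "p e + q * (1 - p e)" "p e"]
      unfolding p_hat_def by (simp add: divide_le_eq)
    show "p e \<le> 1" by fact
  qed
  \<comment> \<open>Columns are indices of edges, since the coordinates of \<open>u\<close> are.\<close>
  define K where "K = enum_dom (P 1)"
  have bij: "bij_betw en K (P 1)" using assms(5) by (simp add: K_def E is_enumeration_def)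
  then have inj: "inj_on en K" and en: "\<And>k. k \<in> K \<Longrightarrow> en k \<in> P 1"
    by (auto simp: bij_betw_def)
  define t where "t k = p_hat p q (en k)" for k
  define N where "N k = {k' \<in> K. en k' \<in> delta P {en k}}" for k
  have N_bij: "bij_betw en (N k) (delta P {en k})" for k
    unfolding bij_betw_def
  proof
    show "inj_on en (N k)" using inj by (rule inj_on_subset) (auto simp: N_def)
    have "delta P {en k} \<subseteq> en ` K" using bij by (auto simp: bij_betw_def delta_def)
    then show "en ` N k = delta P {en k}" by (auto simp: N_def)
  qed
  have g: "g_hat P p q (en k) = 2 * (1 - t k) + 3 * (\<Sum>k'\<in>N k. 1 - t k')" for k
    unfolding g_hat_def t_def using sum.reindex_bij_betw[OF N_bij, of "\<lambda>e. 1 - p_hat p q e"] by simp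
  obtain d where d: "l < ereal d" "ereal d < 1" using ereal_dense2[OF assms(8)] by blast
  \<comment> \<open>\<open>d\<close> can be negative if there are only finitely many edges, as then \<open>l = -\<infinity>\<close>.\<close>
  define \<delta> where "\<delta> = max d 0"
  have "\<forall>\<^sub>F F in finite_subsets_at_top (P 1). (SUP e\<in>P 1 - F. ereal (g_hat P p q e)) < ereal d"
    using order_tendstoD(2)[OF assms(7) d(1)] by (simp add: E)
  then obtain F where F: "finite F" "F \<subseteq> P 1" "(SUP e\<in>P 1 - F. ereal (g_hat P p q e)) < ereal d"
    unfolding eventually_finite_subsets_at_top by blast
  have g_le: "g_hat P p q e \<le> \<delta>" if "e \<in> P 1 - F" for e
  proof -
    have "ereal (g_hat P p q e) \<le> (SUP e\<in>P 1 - F. ereal (g_hat P p q e))"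
      using that by (rule SUP_upper)
    then have "ereal (g_hat P p q e) < ereal d" using F(3) by (rule le_less_trans)
    then show ?thesis by (simp add: \<delta>_def)
  qed
  define \<Lambda> where "\<Lambda> = {k \<in> K. en k \<in> F}"
  have "finite \<Lambda>"
    using finite_vimage_IntI[OF F(1) inj] by (simp add: \<Lambda>_def vimage_def Int_def conj_commute)
  interpret column_percolation K N t \<Lambda> \<delta>
  proof
    show "K \<subseteq> {1..}" by (auto simp: K_def enum_dom_def)
    show "finite (N k)" if "k \<in> K" for k
      using bij_betw_finite[OF N_bij] finite_delta_singleton[OF P en[OF that]] by simp
    show "2 * (1 - t k) + 3 * (\<Sum>k'\<in>N k. 1 - t k') \<le> \<delta>" if "k \<in> K - \<Lambda>" for k
      using g_le[of "en k"] that en by (simp add: g \<Lambda>_def)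
    show "\<delta> < 1" using d by (simp add: \<delta>_def)
    show "t k \<le> 1" if "k \<in> K" for k
      using p_hat[OF en[OF that]] by (simp add: t_def)
  qed (use \<open>finite \<Lambda>\<close> p_hat en in \<open>auto simp: t_def N_def \<Lambda>_def \<delta>_def\<close>)
  fix e assume "e \<in> edges G"
  then obtain k0 where k0: "k0 \<in> K" "e = en k0"
    unfolding E bij_betw_imp_surj_on[OF bij, symmetric] by blast
  show "AE u in color_space. finite (w_cluster_base P p q en u {e})"
    using AE_finite_clusters
  proof eventually_elim
    fix u assume fin: "\<forall>v. snd v \<in> K \<longrightarrow> finite (cluster 0 u v)"
    \<comment> \<open>The cluster of open sites, read as a set of edges, is closed under adding nonblack adjacent
      edges, hence it contains the white cluster.\<close>
    define H where "H = (\<lambda>(n, k). slice n (en k)) ` cluster 0 u (-1, k0)"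
    have "finite H" using fin k0 by (simp add: H_def)
    have nonblack: "\<exists>n k. f = slice n (en k) \<and> is_open 0 u (n, k)"
      if f: "f \<in> edges (star_graph P) - black P p q en u" for f
    proof -
      have "f \<in> white P p en u \<union> gray P p q en u" using f by (auto simp: black_def)
      then obtain n k where "f = slice n (en k)" "(n, k) \<in> color_index" "k \<in> K"
          "p (en k) \<le> u (n, k) \<or> t k \<le> u (n, k)"
        unfolding white_def gray_def t_def K_def by blast
      moreover from this have "t k \<le> u (n, k)"
        using p_hat(2)[OF en[of k]] by (auto simp: t_def)
      ultimately have "f = slice n (en k)" "(n, k) \<in> color_index" "k \<in> K" "t k \<le> u (n, k)"
        by auto
      then show ?thesis by (intro exI[of _ n] exI[of _ k]) (auto simp: is_open_def color_index_def)
    qed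
    have H_edges: "H \<subseteq> edges (star_graph P)"
    proof
      fix f assume "f \<in> H"
      then obtain n k where "(n, k) \<in> cluster 0 u (-1, k0)" "f = slice n (en k)"
        unfolding H_def by auto
      moreover from this have "en k \<in> P 1" using cluster_K[of "(-1, k0)"] k0 en by fastforce
      ultimately show "f \<in> edges (star_graph P)" unfolding edges_star_graph by blast
    qed
    have "delta (star_tess P) H \<subseteq> black P p q en u"
    proof
      fix f assume f: "f \<in> delta (star_tess P) H"
      show "f \<in> black P p q en u"
      proof (rule ccontr)
        assume "f \<notin> black P p q en u"
        moreover have "f \<in> edges (star_graph P)"
          using f by (simp add: delta_def simplicial_graph_def)
        ultimately obtain n k where nk: "f = slice n (en k)" "is_open 0 u (n, k)"
          using nonblack by blast
        obtain m k' \<sigma> where mk: "(m, k') \<in> cluster 0 u (-1, k0)" "f \<notin> H"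
          "\<sigma> \<in> star_tess P DIM(real \<times> 'a)" "f \<subseteq> \<sigma>" "slice m (en k') \<subseteq> \<sigma>"
        proof -
          obtain h \<sigma> where h: "h \<in> H" "f \<notin> H" "\<sigma> \<in> star_tess P DIM(real \<times> 'a)" "f \<subseteq> \<sigma>" "h \<subseteq> \<sigma>"
            using f unfolding delta_def by blast
          moreover from h(1) obtain m k' where "(m, k') \<in> cluster 0 u (-1, k0)" "h = slice m (en k')"
            unfolding H_def by auto
          ultimately show thesis using that by blast
        qed
        have K: "k \<in> K" "k' \<in> K" using nk(2) cluster_K[OF _ mk(1)] k0 by (auto simp: is_open_def)
        note common = slices_in_common_cell[OF P mk(3) mk(4)[unfolded nk(1)] mk(5)
            edge_nonempty[OF P en[OF K(1)]] edge_nonempty[OF P en[OF K(2)]]]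
        have "(n, k) \<in> cluster 0 u (-1, k0)"
        proof (cases "(n, k) = (m, k')")
          case False
          have "k = k' \<or> k \<in> N k'"
            using common(2) K en inj by (auto simp: N_def delta_def inj_on_eq_iff)
          then have "(n, k) \<in> nbr (m, k')" using common(1) False by (auto simp: nbr_def)
          then show ?thesis using mk(1) nk(2) cluster_step by blast
        qed (use mk in simp)
        then have "f \<in> H" unfolding H_def nk(1) by force
        then show False using mk(2) by blast
      qed
    qed
    moreover have "slice (-1) ` {e} - black P p q en u \<subseteq> H"
      using cluster_refl[of "(-1, k0)" 0 u] unfolding H_def k0(2) by force
    moreover have "slice (-1) ` {e} - black P p q en u \<subseteq> edges (star_graph P)"
      using k0 en unfolding edges_star_graph by blast
    ultimately have "w_cluster P p q en u (slice (-1) ` {e} - black P p q en u) \<subseteq> H"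
      using H_edges by (intro w_cluster_minimum(4))
    then show "finite (w_cluster_base P p q en u {e})"
      using finite_subset[OF _ \<open>finite H\<close>] unfolding w_cluster_base_def by simp
  qed
qed

end
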